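(* Let $\Sigma=(G,\sigma)$ be a nonempty signed graph with vertex set $V$, and let $E_+(\Sigma)$, $E_-(\Sigma)$ be the sets of pairs joined by a positive, respectively negative, edge. Let $(\mathrm P_\Sigma)$ be the semidefinite program: minimize $t$ over $t\in\mathbb R$ and real symmetric matrices $X,Y$ indexed by $V$, subject to $X\succeq0$, $Y\succeq0$, $X_{vv}=t-1$ and $Y_{vv}=t$ for all $v\in V$, and $X_{uv}-\sigma(uv)Y_{uv}=-1$ for every signed edge $uv$. The (Lagrangian) dual of $(\mathrm P_\Sigma)$ is the program $(\mathrm D_\Sigma)$: maximize $\langle J,S\rangle$ over real symmetric matrices $S,T$ indexed by $V$, subject to $$S\succeq0,\quad T\succeq0,\quad \operatorname{Tr}(S+T)=1,$$ $$S_{uv}=T_{uv}=0\quad (u\ne v,\ uv\notin E_+(\Sigma)\cup E_-(\Sigma)),$$ $$S_{uv}+T_{uv}=0\quad (u\neq v,\ uv\in E_+(\Sigma)\setminus E_-(\Sigma)),$$ $$S_{uv}-T_{uv}=0\quad (u\neq v,\ uv\in E_-(\Sigma)\setminus E_+(\Sigma)).$$ The optima of $(\mathrm P_\Sigma)$ and $(\mathrm D_\Sigma)$ are both attained and are equal.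
   Context: A signed graph is a pair $\Sigma=(G,\sigma)$ with $G$ a finite graph and $\sigma:E(G)\to\{+1,-1\}$. Positive loops are allowed, negative loops are excluded; between two distinct vertices there may be both a positive and a negative edge (a digon); repeated edges of the same sign are immaterial. Convention: every signed graph is replaced by its completion having a positive loop at every vertex. If both signs occur between $u$ and $v$, both constraints are imposed in $(\mathrm P_\Sigma)$ and no off-diagonal relation at $uv$ is imposed in $(\mathrm D_\Sigma)$. Here $J$ is the all-ones matrix and $\langle A,B\rangle=\operatorname{Tr}(AB)$ on symmetric matrices. *)

theory Defs
  imports "HOL-Analysis.Analysis"
begin

text \<open>
  A signed graph with vertex set \<open>UNIV :: 'v::finite set\<close> (nonempty because types are) is given by
  its set of signed edges \<open>(e, s)\<close>, where the pair \<open>e = {u, v}\<close> is a loop if \<open>u = v\<close>, and \<open>s\<close>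
  is the sign.  Both \<open>(e, 1)\<close> and \<open>(e, -1)\<close> may be present (a digon); repeated edges of the same
  sign, being immaterial, are identified.
\<close>

type_synonym 'v signed_edges = "('v set \<times> int) set"

definition signed_graph :: "('v::finite) signed_edges \<Rightarrow> bool" where
  "signed_graph G \<longleftrightarrow>
     (\<forall>(e, s) \<in> G. (\<exists>u v. e = {u, v}) \<and> s \<in> {1, -1}) \<and> (\<forall>v. ({v}, -1) \<notin> G)"

definition loop_completion :: "('v::finite) signed_edges \<Rightarrow> 'v signed_edges" where
  "loop_completion G = G \<union> {({v}, 1) | v. True}"

definition pos_pairs :: "('v::finite) signed_edges \<Rightarrow> 'v set set" where
  "pos_pairs G = {e. (e, 1) \<in> G}"

definition neg_pairs :: "('v::finite) signed_edges \<Rightarrow> 'v set set" where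
  "neg_pairs G = {e. (e, -1) \<in> G}"

definition symmetric_mat :: "real^'v^'v::finite \<Rightarrow> bool" where
  "symmetric_mat A \<longleftrightarrow> transpose A = A"

definition psd :: "real^'v^'v::finite \<Rightarrow> bool" where
  "psd A \<longleftrightarrow> symmetric_mat A \<and> (\<forall>x. 0 \<le> x \<bullet> (A *v x))"

definition mat_inner :: "real^'v^'v::finite \<Rightarrow> real^'v^'v \<Rightarrow> real" where
  "mat_inner A B = trace (A ** B)"

definition all_ones :: "real^'v^'v::finite" where
  "all_ones = (\<chi> i j. 1)"

definition primal_feasible ::
    "('v::finite) signed_edges \<Rightarrow> real \<Rightarrow> real^'v^'v \<Rightarrow> real^'v^'v \<Rightarrow> bool" where
  "primal_feasible G t X Y \<longleftrightarrow>
     psd X \<and> psd Y \<and>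
     (\<forall>v. X $ v $ v = t - 1) \<and> (\<forall>v. Y $ v $ v = t) \<and>
     (\<forall>u v s. ({u, v}, s) \<in> G \<longrightarrow> X $ u $ v - of_int s * Y $ u $ v = -1)"

definition primal_optimal ::
    "('v::finite) signed_edges \<Rightarrow> real \<Rightarrow> real^'v^'v \<Rightarrow> real^'v^'v \<Rightarrow> bool" where
  "primal_optimal G t X Y \<longleftrightarrow>
     primal_feasible G t X Y \<and> (\<forall>t' X' Y'. primal_feasible G t' X' Y' \<longrightarrow> t \<le> t')"

definition dual_feasible ::
    "('v::finite) signed_edges \<Rightarrow> real^'v^'v \<Rightarrow> real^'v^'v \<Rightarrow> bool" where
  "dual_feasible G S T \<longleftrightarrow>
     psd S \<and> psd T \<and> trace (S + T) = 1 \<and>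
     (\<forall>u v. u \<noteq> v \<and> {u, v} \<notin> pos_pairs G \<union> neg_pairs G \<longrightarrow> S $ u $ v = 0 \<and> T $ u $ v = 0) \<and>
     (\<forall>u v. u \<noteq> v \<and> {u, v} \<in> pos_pairs G - neg_pairs G \<longrightarrow> S $ u $ v + T $ u $ v = 0) \<and>
     (\<forall>u v. u \<noteq> v \<and> {u, v} \<in> neg_pairs G - pos_pairs G \<longrightarrow> S $ u $ v - T $ u $ v = 0)"

definition dual_optimal ::
    "('v::finite) signed_edges \<Rightarrow> real^'v^'v \<Rightarrow> real^'v^'v \<Rightarrow> bool" where
  "dual_optimal G S T \<longleftrightarrow>
     dual_feasible G S T \<and>
     (\<forall>S' T'. dual_feasible G S' T' \<longrightarrow> mat_inner all_ones S' \<le> mat_inner all_ones S)"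

text \<open>
  The Lagrangian of the primal program: \<open>S\<close>, \<open>T\<close> are the multipliers of the conic constraints on
  \<open>X\<close>, \<open>Y\<close>, and \<open>a\<close>, \<open>b\<close>, \<open>m\<close> are those of the three families of equations.  As in
  \<^const>\<open>primal_feasible\<close>, the edge equations are indexed by ordered pairs of end vertices.
\<close>

definition lagrangian ::
    "('v::finite) signed_edges \<Rightarrow> real^'v^'v \<Rightarrow> real^'v^'v \<Rightarrow>
     ('v \<Rightarrow> real) \<Rightarrow> ('v \<Rightarrow> real) \<Rightarrow> ('v \<times> 'v \<times> int \<Rightarrow> real) \<Rightarrow>
     real \<Rightarrow> real^'v^'v \<Rightarrow> real^'v^'v \<Rightarrow> real" where
  "lagrangian G S T a b m t X Y =
     t - mat_inner S X - mat_inner T Y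
     + (\<Sum>v\<in>UNIV. a v * (X $ v $ v - (t - 1)))
     + (\<Sum>v\<in>UNIV. b v * (Y $ v $ v - t))
     + (\<Sum>(u, v, s) | ({u, v}, s) \<in> G.
          m (u, v, s) * (X $ u $ v - of_int s * Y $ u $ v + 1))"

definition lagrange_dual_fun ::
    "('v::finite) signed_edges \<Rightarrow> real^'v^'v \<Rightarrow> real^'v^'v \<Rightarrow>
     ('v \<Rightarrow> real) \<Rightarrow> ('v \<Rightarrow> real) \<Rightarrow> ('v \<times> 'v \<times> int \<Rightarrow> real) \<Rightarrow> ereal" where
  "lagrange_dual_fun G S T a b m =
     (INF (t, X, Y) \<in> {(t, X, Y). symmetric_mat X \<and> symmetric_mat Y}.
        ereal (lagrangian G S T a b m t X Y))"

text \<open>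
  The Lagrangian dual maximizes \<^const>\<open>lagrange_dual_fun\<close> over positive semidefinite \<open>S\<close>, \<open>T\<close> and
  free \<open>a\<close>, \<open>b\<close>, \<open>m\<close>; its feasible points are those where this function is finite.  The predicate
  below says that, after elimination of \<open>a\<close>, \<open>b\<close>, \<open>m\<close>, the feasible points and their objective
  values are exactly those of the program on \<open>(S, T)\<close> with constraint \<open>F\<close> and objective \<open>f\<close>.
\<close>

definition is_lagrangian_dual ::
    "('v::finite) signed_edges \<Rightarrow> (real^'v^'v \<Rightarrow> real^'v^'v \<Rightarrow> bool) \<Rightarrow>
     (real^'v^'v \<Rightarrow> real^'v^'v \<Rightarrow> real) \<Rightarrow> bool" where
  "is_lagrangian_dual G F f \<longleftrightarrow>
     {(S, T, d). psd S \<and> psd T \<and> (\<exists>a b m. lagrange_dual_fun G S T a b m = ereal d)}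
     = {(S, T, d). F S T \<and> d = f S T}"

end

theory Submission imports Defs begin

text \<open>
  The Lagrangian is affine, so its infimum over symmetric matrices is finite only if it is constant;
  testing its linear part on a few directions gives the dual constraints, and its value at
  \<open>(0, -J, 0)\<close> is the dual objective.  The dual feasible set is compact and nonempty, so the dual
  optimum \<open>d\<close> is attained.  The identity is an interior point of the cone compatible with the dual
  edge constraints; hence the solutions of the primal equations at \<open>t = d\<close> need only be separated
  from a compact slice of the cone, and a separating functional would improve on \<open>d\<close>.  Thus the
  primal program is feasible at \<open>t = d\<close>, which is optimal by weak duality.
\<close>

section \<open>Positive semidefinite matrices\<close>

text \<open>Pairing with this rank-one matrix turns the quadratic form at \<open>x\<close> into a
  linear functional of the matrix, so positivity becomes a family of closed linear
  inequalities.\<close>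

definition outer :: "real^'n \<Rightarrow> real^'n^'n::finite" where
  "outer x = (\<chi> i j. x $ i * x $ j)"

lemma inner_matrix_sum: "A \<bullet> B = (\<Sum>i\<in>UNIV. \<Sum>j\<in>UNIV. A $ i $ j * B $ i $ j)"
  for A B :: "real^'n^'m::finite"
  by (simp add: inner_vec_def)

lemma quadratic_form_sum: "x \<bullet> (A *v x) = (\<Sum>i\<in>UNIV. \<Sum>j\<in>UNIV. A $ i $ j * (x $ i * x $ j))"
  for A :: "real^'n^'n::finite"
  by (simp add: inner_vec_def matrix_vector_mult_def sum_distrib_left mult_ac)

lemma inner_outer: "A \<bullet> outer x = x \<bullet> (A *v x)"
  by (simp add: inner_matrix_sum quadratic_form_sum outer_def)

lemma quadratic_form_outer: "y \<bullet> (outer x *v y) = (x \<bullet> y)\<^sup>2"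
  unfolding quadratic_form_sum
  by (simp add: outer_def inner_vec_def power2_eq_square sum_product mult_ac)

lemma trace_eq_inner: "trace A = A \<bullet> mat 1"
proof -
  have "A \<bullet> mat 1 = (\<Sum>i\<in>UNIV. \<Sum>j\<in>UNIV. if i = j then A $ i $ j else 0)"
    unfolding inner_matrix_sum by (intro sum.cong refl) (simp add: mat_def)
  then show ?thesis by (simp add: trace_def)
qed

lemma trace_outer: "trace (outer x) = x \<bullet> x"
  by (simp add: trace_def outer_def inner_vec_def)

lemma symmetric_mat_iff: "symmetric_mat A \<longleftrightarrow> (\<forall>i j. A $ i $ j = A $ j $ i)"
  by (auto simp: symmetric_mat_def transpose_def vec_eq_iff)

lemma symmetric_matD: "symmetric_mat A \<Longrightarrow> A $ i $ j = A $ j $ i"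
  by (simp add: symmetric_mat_iff)

lemma inner_transpose: "transpose A \<bullet> B = A \<bullet> transpose B"
  for A :: "real^'n^'m::finite"
  unfolding inner_matrix_sum transpose_def by (subst sum.swap) simp

lemma mat_inner_eq_inner: "symmetric_mat B \<Longrightarrow> mat_inner A B = A \<bullet> B"
  unfolding mat_inner_def trace_def inner_matrix_sum matrix_matrix_mult_def
  by (auto intro!: sum.cong dest: symmetric_matD)

lemma symmetric_all_ones: "symmetric_mat all_ones"
  by (simp add: symmetric_mat_iff all_ones_def)

lemma symmetric_mat_1: "symmetric_mat (mat 1)"
  by (auto simp: symmetric_mat_iff mat_def)

lemma symmetric_mat_add: "symmetric_mat A \<Longrightarrow> symmetric_mat B \<Longrightarrow> symmetric_mat (A + B)"
  by (simp add: symmetric_mat_iff)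

lemma symmetric_mat_scaleR: "symmetric_mat A \<Longrightarrow> symmetric_mat (r *\<^sub>R A)"
  by (simp add: symmetric_mat_iff)

lemma psd_outer: "psd (outer x)"
  unfolding psd_def quadratic_form_outer by (simp add: symmetric_mat_iff outer_def mult.commute)

lemma psd_iff: "psd A \<longleftrightarrow> symmetric_mat A \<and> (\<forall>x. 0 \<le> A \<bullet> outer x)"
  by (simp add: psd_def inner_outer)

lemma psd_scaleR: "psd A \<Longrightarrow> 0 \<le> r \<Longrightarrow> psd (r *\<^sub>R A)"
  by (auto simp: psd_iff symmetric_mat_scaleR)

lemma psd_add: "psd A \<Longrightarrow> psd B \<Longrightarrow> psd (A + B)"
  by (auto simp: psd_iff symmetric_mat_add inner_add_left)

lemma psd_0: "psd 0"
  by (simp add: psd_iff symmetric_mat_iff)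

lemma inner_outer_axis: "A \<bullet> outer (axis i 1) = A $ i $ i"
  by (simp add: inner_outer matrix_vector_mult_basis inner_axis' column_def)

lemma psd_diag_nonneg: "psd A \<Longrightarrow> 0 \<le> A $ i $ i"
  using psd_iff[of A] inner_outer_axis[of A i] by metis

text \<open>Steps \<open>r = 1\<close> and \<open>r = -1\<close> from another basis vector bound
  off-diagonal entries; minimising over \<open>r\<close> completes the square in the elimination
  below.\<close>

lemma quadratic_form_line:
  assumes "symmetric_mat A"
  shows "A \<bullet> outer (x + r *\<^sub>R axis i 1)
           = A \<bullet> outer x + 2 * r * (column i A \<bullet> x) + r\<^sup>2 * A $ i $ i"
proof -
  have "axis i 1 \<bullet> (A *v x) = column i A \<bullet> x"
    unfolding inner_axis' using symmetric_matD[OF assms, of i]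
    by (simp add: matrix_vector_mult_def column_def inner_vec_def)
  moreover have "x \<bullet> (A *v axis i 1) = column i A \<bullet> x"
    by (simp add: matrix_vector_mult_basis inner_commute)
  moreover have "axis i 1 \<bullet> (A *v axis i 1) = A $ i $ i"
    by (simp add: matrix_vector_mult_basis inner_axis' column_def)
  ultimately show ?thesis
    by (simp add: inner_outer matrix_vector_right_distrib inner_add_left inner_add_right
        matrix_vector_mult_scaleR power2_eq_square algebra_simps)
qed

lemma psd_offdiag_le:
  assumes "psd A"
  shows "2 * \<bar>A $ i $ j\<bar> \<le> A $ i $ i + A $ j $ j"
proof -
  have *: "0 \<le> A $ j $ j + 2 * r * A $ j $ i + r\<^sup>2 * A $ i $ i" for r
  proof -
    have "0 \<le> A \<bullet> outer (axis j 1 + r *\<^sub>R axis i 1)"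
      using assms psd_iff by blast
    also have "\<dots> = A $ j $ j + 2 * r * A $ j $ i + r\<^sup>2 * A $ i $ i"
      using assms by (subst quadratic_form_line)
        (auto simp: psd_def inner_outer_axis inner_axis column_def)
    finally show ?thesis .
  qed
  have "A $ j $ i = A $ i $ j"
    using assms by (auto simp: psd_def dest: symmetric_matD)
  with *[of 1] *[of "-1"] show ?thesis by auto
qed

lemma psd_entry_le_trace:
  assumes "psd A"
  shows "\<bar>A $ i $ j\<bar> \<le> trace A"
proof -
  have "A $ k $ k \<le> trace A" for k
    unfolding trace_def by (rule member_le_sum) (auto intro: psd_diag_nonneg[OF assms])
  from this[of i] this[of j] psd_offdiag_le[OF assms, of i j] show ?thesis by linarith
qed

lemma psd_trace_nonneg: "psd A \<Longrightarrow> 0 \<le> trace A"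
  unfolding trace_def by (simp add: sum_nonneg psd_diag_nonneg)

text \<open>Cholesky elimination: subtracting a rank-one positive semidefinite matrix clears one
  diagonal entry of \<open>A\<close> and preserves the vanishing ones.\<close>

lemma psd_inner_nonneg:
  assumes "psd A" "psd B"
  shows "0 \<le> A \<bullet> B"
  using assms(1)
proof (induction "card {i. A $ i $ i \<noteq> 0}" arbitrary: A rule: less_induct)
  case less
  show ?case
  proof (cases "\<exists>i. A $ i $ i \<noteq> 0")
    case False
    \<comment> \<open>A positive semidefinite matrix with zero diagonal is zero.\<close>
    then have "A $ i $ j = 0" for i j
      using psd_offdiag_le[OF less.prems, of i j] by auto
    then show ?thesis by (simp add: inner_matrix_sum)
  next
    case True
    then obtain i where i: "A $ i $ i \<noteq> 0" by blast
    then have pos: "A $ i $ i > 0"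
      using psd_diag_nonneg[OF less.prems, of i] by linarith
    define c where "c = column i A"
    define A' where "A' = A - (1 / A $ i $ i) *\<^sub>R outer c"
    have sym: "symmetric_mat A" using less.prems by (simp add: psd_def)
    have "0 \<le> A' \<bullet> outer x" for x
    proof -
      \<comment> \<open>This step length minimises the quadratic form of \<open>A\<close> along the
        \<open>i\<close>-th coordinate line through \<open>x\<close>; the minimum is the form of the
        Schur complement \<open>A'\<close> at \<open>x\<close>.\<close>
      have "0 \<le> A \<bullet> outer (x + (- (c \<bullet> x) / A $ i $ i) *\<^sub>R axis i 1)"
        using less.prems psd_iff by blast
      also have "\<dots> = A \<bullet> outer x - (c \<bullet> x)\<^sup>2 / A $ i $ i"
        unfolding quadratic_form_line[OF sym] using i
        by (simp add: c_def[symmetric] field_simps power2_eq_square)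
      also have "\<dots> = A' \<bullet> outer x"
        by (simp add: A'_def inner_diff_left)
          (simp add: inner_outer quadratic_form_outer)
      finally show ?thesis .
    qed
    moreover have "symmetric_mat A'"
      using sym by (simp add: A'_def symmetric_mat_iff outer_def mult.commute)
    ultimately have psd': "psd A'" by (simp add: psd_iff)
    have diag: "A' $ j $ j = A $ j $ j - (c $ j)\<^sup>2 / A $ i $ i" for j
      by (simp add: A'_def outer_def power2_eq_square)
    have "A' $ i $ i = 0"
      using i by (simp add: diag c_def column_def power2_eq_square)
    \<comment> \<open>If \<open>A $ j $ j = 0\<close>, the new entry is minus a square over a
      positive number, yet nonnegative because \<open>A'\<close> is positive semidefinite.\<close>
    moreover have "A' $ j $ j = 0" if "A $ j $ j = 0" for j
      using psd_diag_nonneg[OF psd', of j] that pos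
      by (simp add: diag) (simp add: divide_le_0_iff)
    ultimately have "{j. A' $ j $ j \<noteq> 0} \<subset> {j. A $ j $ j \<noteq> 0}"
      using i by auto
    then have "0 \<le> A' \<bullet> B"
      using less.hyps[OF _ psd'] psubset_card_mono[OF finite] by blast
    moreover have "0 \<le> outer c \<bullet> B"
      using assms(2) by (simp add: psd_iff inner_commute)
    moreover have "A \<bullet> B = A' \<bullet> B + (1 / A $ i $ i) * (outer c \<bullet> B)"
      by (simp add: A'_def inner_diff_left)
    ultimately show ?thesis using pos by simp
  qed
qed

section \<open>Compactness and convexity of trace slices of the cone\<close>

lemma compact_psd_trace:
  "compact {(X, Y). psd X \<and> psd Y \<and> trace (X + Y) = c}" (is "compact ?P")
proof -
  have "?P = {p. \<forall>i j. fst p $ i $ j = fst p $ j $ i \<and> snd p $ i $ j = snd p $ j $ i}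
     \<inter> {p. \<forall>x. 0 \<le> fst p \<bullet> outer x \<and> 0 \<le> snd p \<bullet> outer x}
     \<inter> {p. (fst p + snd p) \<bullet> mat 1 = c}"
    by (auto simp: psd_iff symmetric_mat_iff trace_eq_inner)
  also have "closed \<dots>"
    by (intro closed_Int closed_Collect_all closed_Collect_conj closed_Collect_eq
        closed_Collect_le continuous_intros)
  finally have "closed ?P" .
  moreover have "bounded ?P"
  proof -
    \<comment> \<open>Every entry is at most the trace in absolute value; writing
      \<open>\<bar>c\<bar>\<close> gives a bound that makes sense for every sign of
      \<open>c\<close>.\<close>
    have *: "norm X \<le> (\<Sum>i\<in>(UNIV::'a set). \<Sum>j\<in>(UNIV::'a set). \<bar>c\<bar>)"
      if "psd X" "trace X \<le> c" for X :: "real^'a^'a"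
    proof -
      have "norm X \<le> (\<Sum>i\<in>UNIV. norm (X $ i))"
        by (simp add: norm_vec_def L2_set_le_sum)
      also have "\<dots> \<le> (\<Sum>i\<in>UNIV. \<Sum>j\<in>UNIV. \<bar>X $ i $ j\<bar>)"
        by (intro sum_mono norm_le_l1_cart)
      also have "\<dots> \<le> (\<Sum>i\<in>(UNIV::'a set). \<Sum>j\<in>(UNIV::'a set). \<bar>c\<bar>)"
        using psd_entry_le_trace[OF that(1)] that(2) by (intro sum_mono) (smt (verit))
      finally show ?thesis .
    qed
    have "norm (X, Y) \<le> 2 * (\<Sum>i\<in>(UNIV::'a set). \<Sum>j\<in>(UNIV::'a set). \<bar>c\<bar>)"
      if "psd X" "psd Y" "trace (X + Y) = c" for X Y :: "real^'a^'a"
    proof -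
      have "trace X \<le> c" "trace Y \<le> c"
        using that psd_trace_nonneg[of X] psd_trace_nonneg[of Y] by (auto simp: trace_add)
      then show ?thesis
        using *[of X] *[of Y] that norm_Pair_le[of X Y] by linarith
    qed
    then show ?thesis unfolding bounded_iff by blast
  qed
  ultimately show ?thesis by (simp add: compact_eq_bounded_closed)
qed

lemma convex_psd_trace: "convex {(X, Y). psd X \<and> psd Y \<and> trace (X + Y) = c}"
proof (rule convexI; clarsimp)
  fix X Y X' Y' :: "real^'a^'a" and u v :: real
  assume *: "psd X" "psd Y" "psd X'" "psd Y'" "trace (X' + Y') = trace (X + Y)"
    and uv: "0 \<le> u" "0 \<le> v" "u + v = 1"
  have "trace (u *\<^sub>R X + v *\<^sub>R X' + (u *\<^sub>R Y + v *\<^sub>R Y'))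
          = u * trace (X + Y) + v * trace (X' + Y')"
    by (simp add: trace_eq_inner inner_add_left algebra_simps)
  also have "\<dots> = trace (X + Y)"
    using * uv by (metis distrib_right mult_1)
  finally show "psd (u *\<^sub>R X + v *\<^sub>R X') \<and> psd (u *\<^sub>R Y + v *\<^sub>R Y') \<and>
      trace (u *\<^sub>R X + v *\<^sub>R X' + (u *\<^sub>R Y + v *\<^sub>R Y')) = trace (X + Y)"
    using * uv by (auto intro!: psd_add psd_scaleR)
qed

lemma affine_bounded_below_const:
  fixes k :: real
  assumes "\<And>r. d \<le> c + r * k"
  shows "k = 0"
proof (rule ccontr)
  assume "k \<noteq> 0"
  \<comment> \<open>At this \<open>r\<close> the affine function takes the value
    \<open>d - 1\<close>.\<close>
  with assms[of "(d - c - 1) / k"] show False by simp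
qed

section \<open>Edge constraints and weak duality\<close>

lemma signed_graph_sign: "signed_graph G \<Longrightarrow> (e, s) \<in> G \<Longrightarrow> s = 1 \<or> s = -1"
  unfolding signed_graph_def by fastforce

lemma signed_graph_loop_sign: "signed_graph G \<Longrightarrow> ({v}, s) \<in> G \<Longrightarrow> s = 1"
  using signed_graph_sign[of G "{v}" s] unfolding signed_graph_def by auto

lemma signed_graph_loop_completion: "signed_graph G \<Longrightarrow> signed_graph (loop_completion G)"
  unfolding signed_graph_def loop_completion_def by fastforce

text \<open>The homogeneous linear part of dual feasibility: it survives rescaling and can be tested
  by orthogonality, apart from the cone and the trace.\<close>

definition edge_relations :: "('v::finite) signed_edges \<Rightarrow> real^'v^'v \<Rightarrow> real^'v^'v \<Rightarrow> bool" where
  "edge_relations G S T \<longleftrightarrow>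
     (\<forall>u v. u \<noteq> v \<and> {u, v} \<notin> pos_pairs G \<union> neg_pairs G \<longrightarrow> S $ u $ v = 0 \<and> T $ u $ v = 0) \<and>
     (\<forall>u v. u \<noteq> v \<and> {u, v} \<in> pos_pairs G - neg_pairs G \<longrightarrow> S $ u $ v + T $ u $ v = 0) \<and>
     (\<forall>u v. u \<noteq> v \<and> {u, v} \<in> neg_pairs G - pos_pairs G \<longrightarrow> S $ u $ v - T $ u $ v = 0)"

lemma dual_feasible_iff:
  "dual_feasible G S T \<longleftrightarrow> psd S \<and> psd T \<and> trace (S + T) = 1 \<and> edge_relations G S T"
  unfolding dual_feasible_def edge_relations_def by blast

text \<open>The directions \<open>(A, B)\<close> in which the solutions of the primal equations are translation
  invariant when \<open>t\<close> is fixed.\<close>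

definition edge_direction :: "('v::finite) signed_edges \<Rightarrow> real^'v^'v \<Rightarrow> real^'v^'v \<Rightarrow> bool" where
  "edge_direction G A B \<longleftrightarrow> symmetric_mat A \<and> symmetric_mat B \<and>
     (\<forall>v. A $ v $ v = 0 \<and> B $ v $ v = 0) \<and>
     (\<forall>u v s. ({u, v}, s) \<in> G \<longrightarrow> A $ u $ v = of_int s * B $ u $ v)"

text \<open>Test directions supported on a single pair suffice. The signs present on the pair
  restrict the coefficients: none for a non-edge, \<open>a = b\<close> or \<open>a = -b\<close> for
  a single sign, and only zero for a digon, which therefore yields no relation.\<close>

lemma edge_relations_if_orthogonal:
  assumes G: "signed_graph G" and sym: "symmetric_mat S" "symmetric_mat T"
    and orth: "\<And>A B. edge_direction G A B \<Longrightarrow> S \<bullet> A + T \<bullet> B = 0"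
  shows "edge_relations G S T"
proof -
  define W :: "'a \<Rightarrow> 'a \<Rightarrow> real^'a^'a" where
    "W u v = axis u (axis v 1) + axis v (axis u 1)" for u v
  have W_entry: "W u v $ i $ j = 0" if "{i, j} \<noteq> {u, v}" for u v i j
    using that by (auto simp: W_def axis_def)
  have W_sym: "symmetric_mat (W u v)" for u v
    by (auto simp: symmetric_mat_iff W_def axis_def)
  have W_diag: "W u v $ i $ i = 0" if "u \<noteq> v" for u v i
    using that by (intro W_entry) auto
  have W_inner: "M \<bullet> W u v = 2 * M $ u $ v" if "symmetric_mat M" for M u v
    using symmetric_matD[OF that, of u v] by (simp add: W_def inner_add_right inner_axis)
  have key: "a * S $ u $ v + b * T $ u $ v = 0"
    if "u \<noteq> v" and ab: "\<And>s. ({u, v}, s) \<in> G \<Longrightarrow> a = of_int s * b" for u v a b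
  proof -
    have "edge_direction G (a *\<^sub>R W u v) (b *\<^sub>R W u v)"
      unfolding edge_direction_def
    proof (intro conjI allI impI)
      fix i j s assume e: "({i, j}, s) \<in> G"
      show "(a *\<^sub>R W u v) $ i $ j = of_int s * (b *\<^sub>R W u v) $ i $ j"
      proof (cases "{i, j} = {u, v}")
        case True
        with ab e have "a = of_int s * b" by simp
        then show ?thesis by simp
      qed (simp add: W_entry)
    qed (auto simp: W_sym W_diag symmetric_mat_scaleR \<open>u \<noteq> v\<close>)
    from orth[OF this] show ?thesis by (simp add: W_inner sym)
  qed
  have sign: "s = 1 \<and> e \<in> pos_pairs G \<or> s = -1 \<and> e \<in> neg_pairs G" if "(e, s) \<in> G" for e s
    using signed_graph_sign[OF G that] that by (auto simp: pos_pairs_def neg_pairs_def)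
  show ?thesis
    unfolding edge_relations_def
  proof (intro conjI allI impI; elim conjE)
    fix u v assume *: "u \<noteq> v" "{u, v} \<notin> pos_pairs G \<union> neg_pairs G"
    show "S $ u $ v = 0"
      using key[of u v 1 0] * sign by fastforce
    show "T $ u $ v = 0"
      using key[of u v 0 1] * sign by fastforce
  next
    fix u v assume *: "u \<noteq> v" "{u, v} \<in> pos_pairs G - neg_pairs G"
    show "S $ u $ v + T $ u $ v = 0"
      using key[of u v 1 1] * sign by fastforce
  next
    fix u v assume *: "u \<noteq> v" "{u, v} \<in> neg_pairs G - pos_pairs G"
    show "S $ u $ v - T $ u $ v = 0"
      using key[of u v 1 "-1"] * sign by fastforce
  qed
qed

text \<open>Off the diagonal these values solve m(+) + m(-) = S and m(-) - m(+) = T, the conditions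
  for cancelling X and Y. If a sign is absent, the dual relation makes its value zero. Loops get
  zero because the diagonal equations carry the diagonal of S and T.\<close>

definition edge_multiplier :: "real^'v^'v \<Rightarrow> real^'v^'v \<Rightarrow> 'v \<times> 'v \<times> int \<Rightarrow> real" where
  "edge_multiplier S T =
     (\<lambda>(u, v, s). if u = v then 0 else (S $ u $ v - of_int s * T $ u $ v) / 2)"

lemma sum_signed_edges:
  fixes f :: "'v::finite \<Rightarrow> 'v \<Rightarrow> int \<Rightarrow> real"
  assumes "signed_graph G"
  shows "(\<Sum>(u, v, s) | ({u, v}, s) \<in> G. f u v s)
           = (\<Sum>u\<in>UNIV. \<Sum>v\<in>UNIV. (if {u, v} \<in> pos_pairs G then f u v 1 else 0)
                + (if {u, v} \<in> neg_pairs G then f u v (-1) else 0))"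
proof -
  have "{(u, v, s). ({u, v}, s) \<in> G}
          = {p \<in> UNIV \<times> UNIV \<times> {1, -1}. case p of (u, v, s) \<Rightarrow> ({u, v}, s) \<in> G}"
    using signed_graph_sign[OF assms] by auto
  then have "(\<Sum>(u, v, s) | ({u, v}, s) \<in> G. f u v s)
     = (\<Sum>(u, v, s) \<in> UNIV \<times> UNIV \<times> {1, -1}. if ({u, v}, s) \<in> G then f u v s else 0)"
    by (simp add: sum.inter_filter split_def)
  also have "\<dots> = (\<Sum>u\<in>UNIV. \<Sum>v\<in>UNIV. \<Sum>s\<in>{1, -1}. if ({u, v}, s) \<in> G then f u v s else 0)"
    by (simp only: sum.cartesian_product split_def)
  finally show ?thesis
    by (simp add: pos_pairs_def neg_pairs_def)
qed

text \<open>The edge terms cancel the off-diagonal entries of X and Y, the diagonal multipliers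
  cancel the rest, and the trace condition cancels \<open>t\<close>. The constants left over add up
  to the entries of S.\<close>

lemma lagrangian_dual_feasible:
  assumes G: "signed_graph G" and D: "dual_feasible G S T"
    and sym: "symmetric_mat X" "symmetric_mat Y"
  shows "lagrangian G S T (\<lambda>v. S $ v $ v) (\<lambda>v. T $ v $ v) (edge_multiplier S T) t X Y
           = mat_inner all_ones S"
proof -
  \<comment> \<open>The diagonal contribution, which the edge sum misses because loops have
    multiplier zero.\<close>
  let ?D = "\<lambda>u v. if u = v then S $ u $ v * (X $ u $ v + 1) + T $ u $ v * Y $ u $ v else 0"
  let ?m = "edge_multiplier S T"
  have S: "symmetric_mat S" using D by (simp add: dual_feasible_def psd_def)
  have "(\<Sum>(u, v, s) | ({u, v}, s) \<in> G. ?m (u, v, s) * (X $ u $ v - of_int s * Y $ u $ v + 1))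
      = (\<Sum>u\<in>UNIV. \<Sum>v\<in>UNIV.
          (if {u, v} \<in> pos_pairs G then ?m (u, v, 1) * (X $ u $ v - Y $ u $ v + 1) else 0)
        + (if {u, v} \<in> neg_pairs G then ?m (u, v, -1) * (X $ u $ v + Y $ u $ v + 1) else 0))"
    unfolding sum_signed_edges[OF G] by (intro sum.cong refl) simp
  also have "\<dots> = (\<Sum>u\<in>UNIV. \<Sum>v\<in>UNIV. S $ u $ v * (X $ u $ v + 1) + T $ u $ v * Y $ u $ v - ?D u v)"
  proof (intro sum.cong refl)
    fix u v
    show "(if {u, v} \<in> pos_pairs G then ?m (u, v, 1) * (X $ u $ v - Y $ u $ v + 1) else 0)
        + (if {u, v} \<in> neg_pairs G then ?m (u, v, -1) * (X $ u $ v + Y $ u $ v + 1) else 0)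
        = S $ u $ v * (X $ u $ v + 1) + T $ u $ v * Y $ u $ v - ?D u v"
    proof (cases "u = v")
      case False
      consider "{u, v} \<notin> pos_pairs G \<union> neg_pairs G" | "{u, v} \<in> pos_pairs G - neg_pairs G"
        | "{u, v} \<in> neg_pairs G - pos_pairs G" | "{u, v} \<in> pos_pairs G \<inter> neg_pairs G"
        by blast
      then show ?thesis
      proof cases
        case 1
        then have "S $ u $ v = 0" "T $ u $ v = 0"
          using D False unfolding dual_feasible_def by blast+
        with 1 False show ?thesis by (simp add: edge_multiplier_def)
      next
        case 2
        then have "S $ u $ v + T $ u $ v = 0"
          using D False unfolding dual_feasible_def by blast
        then have "T $ u $ v = - S $ u $ v" by simp
        with 2 False show ?thesis by (simp add: edge_multiplier_def algebra_simps)
      next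
        case 3
        then have "S $ u $ v - T $ u $ v = 0"
          using D False unfolding dual_feasible_def by blast
        then have "T $ u $ v = S $ u $ v" by simp
        with 3 False show ?thesis by (simp add: edge_multiplier_def algebra_simps)
      next
        case 4
        with False show ?thesis by (simp add: edge_multiplier_def field_simps)
      qed
    qed (simp add: edge_multiplier_def)
  qed
  also have "\<dots> = S \<bullet> X + T \<bullet> Y + S \<bullet> all_ones
      - (\<Sum>v\<in>UNIV. S $ v $ v * (X $ v $ v + 1) + T $ v $ v * Y $ v $ v)"
    by (simp add: sum_subtractf sum.distrib inner_matrix_sum all_ones_def algebra_simps)
  finally have edges: "(\<Sum>(u, v, s) | ({u, v}, s) \<in> G.
      ?m (u, v, s) * (X $ u $ v - of_int s * Y $ u $ v + 1)) = \<dots>" .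
  have "trace (S + T) = 1" using D by (simp add: dual_feasible_def)
  then have "(\<Sum>v\<in>UNIV. S $ v $ v * t) + (\<Sum>v\<in>UNIV. T $ v $ v * t) = t"
    by (simp add: trace_def sum_distrib_right[symmetric] sum.distrib distrib_right[symmetric])
  with edges show ?thesis
    unfolding lagrangian_def mat_inner_eq_inner[OF sym(1)] mat_inner_eq_inner[OF sym(2)]
      mat_inner_eq_inner[OF S]
    by (simp add: algebra_simps sum.distrib sum_subtractf inner_commute[of all_ones])
qed

text \<open>At a primal feasible point the equation terms vanish, so the constant Lagrangian equals
  \<open>t\<close> minus two pairings of positive semidefinite matrices.\<close>

lemma weak_duality:
  assumes G: "signed_graph G" and P: "primal_feasible G t X Y" and D: "dual_feasible G S T"
  shows "mat_inner all_ones S \<le> t"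
proof -
  have sym: "symmetric_mat X" "symmetric_mat Y"
    using P by (auto simp: primal_feasible_def psd_def)
  have "lagrangian G S T (\<lambda>v. S $ v $ v) (\<lambda>v. T $ v $ v) (edge_multiplier S T) t X Y
          = t - S \<bullet> X - T \<bullet> Y"
    using P unfolding lagrangian_def primal_feasible_def
    by (auto simp: mat_inner_eq_inner sym intro!: sum.neutral)
  moreover have "0 \<le> S \<bullet> X" "0 \<le> T \<bullet> Y"
    using P D by (auto simp: primal_feasible_def dual_feasible_def intro!: psd_inner_nonneg)
  ultimately show ?thesis
    using lagrangian_dual_feasible[OF G D sym, of t] by linarith
qed

section \<open>The Lagrangian dual\<close>

text \<open>All equations of the primal program hold at the base point \<open>(t, X, Y) = (0, -J, 0)\<close>, so the
  terms of \<open>a\<close>, \<open>b\<close> and \<open>m\<close> contribute nothing to the constant.\<close>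

lemma lagrangian_line:
  "lagrangian G S T a b m (r * t) (r *\<^sub>R X - all_ones) (r *\<^sub>R Y)
     = mat_inner S all_ones + r * (t - mat_inner S X - mat_inner T Y
       + (\<Sum>v\<in>UNIV. a v * (X $ v $ v - t)) + (\<Sum>v\<in>UNIV. b v * (Y $ v $ v - t))
       + (\<Sum>(u, v, s) | ({u, v}, s) \<in> G. m (u, v, s) * (X $ u $ v - of_int s * Y $ u $ v)))"
proof -
  have [simp]: "mat_inner A (r *\<^sub>R B - C) = r * mat_inner A B - mat_inner A C"
    "mat_inner A (r *\<^sub>R B) = r * mat_inner A B" for A B C :: "real^'a^'a"
    by (simp_all add: mat_inner_def trace_def matrix_matrix_mult_def algebra_simps
        sum_subtractf sum_distrib_left)
  have "(\<Sum>v\<in>UNIV. a v * ((r *\<^sub>R X - all_ones) $ v $ v - (r * t - 1)))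
          = r * (\<Sum>v\<in>UNIV. a v * (X $ v $ v - t))"
    unfolding sum_distrib_left by (intro sum.cong) (auto simp: all_ones_def algebra_simps)
  moreover have "(\<Sum>v\<in>UNIV. b v * ((r *\<^sub>R Y) $ v $ v - r * t))
          = r * (\<Sum>v\<in>UNIV. b v * (Y $ v $ v - t))"
    unfolding sum_distrib_left by (intro sum.cong) (auto simp: algebra_simps)
  moreover have "(\<Sum>(u, v, s) | ({u, v}, s) \<in> G.
        m (u, v, s) * ((r *\<^sub>R X - all_ones) $ u $ v - of_int s * (r *\<^sub>R Y) $ u $ v + 1))
      = r * (\<Sum>(u, v, s) | ({u, v}, s) \<in> G. m (u, v, s) * (X $ u $ v - of_int s * Y $ u $ v))"
    unfolding sum_distrib_left by (intro sum.cong) (auto simp: all_ones_def algebra_simps)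
  ultimately show ?thesis
    unfolding lagrangian_def by (simp add: algebra_simps)
qed

lemma lagrange_dual_fun_const:
  assumes "\<And>t X Y. symmetric_mat X \<Longrightarrow> symmetric_mat Y \<Longrightarrow> lagrangian G S T a b m t X Y = c"
  shows "lagrange_dual_fun G S T a b m = ereal c"
proof -
  have "(\<lambda>(t, X, Y). ereal (lagrangian G S T a b m t X Y))
          ` {(t, X, Y). symmetric_mat X \<and> symmetric_mat Y} = {ereal c}"
    \<comment> \<open>The symmetric matrix \<open>all_ones\<close> witnesses that the infimum ranges
      over a nonempty set.\<close>
    using assms symmetric_all_ones by (force simp: image_iff)
  then show ?thesis by (simp add: lagrange_dual_fun_def)
qed

lemma dual_feasible_if_lagrange_dual_fun_finite:
  assumes G: "signed_graph G" and psd: "psd S" "psd T"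
    and fin: "lagrange_dual_fun G S T a b m = ereal d"
  shows "dual_feasible G S T \<and> d = mat_inner all_ones S"
proof -
  \<comment> \<open>The linear part of the Lagrangian, read off from
    \<open>lagrangian_line\<close>.\<close>
  define slope where "slope t X Y = t - mat_inner S X - mat_inner T Y
       + (\<Sum>v\<in>UNIV. a v * (X $ v $ v - t)) + (\<Sum>v\<in>UNIV. b v * (Y $ v $ v - t))
       + (\<Sum>(u, v, s) | ({u, v}, s) \<in> G. m (u, v, s) * (X $ u $ v - of_int s * Y $ u $ v))"
    for t X Y
  have symST: "symmetric_mat S" "symmetric_mat T"
    using psd by (auto simp: psd_def)
  have lower: "d \<le> lagrangian G S T a b m t X Y"
    if "symmetric_mat X" "symmetric_mat Y" for t X Y
  proof -
    have "lagrange_dual_fun G S T a b m \<le> ereal (lagrangian G S T a b m t X Y)"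
      unfolding lagrange_dual_fun_def by (rule INF_lower2[of "(t, X, Y)"]) (use that in auto)
    with fin show ?thesis by simp
  qed
  have zero: "slope t X Y = 0" if "symmetric_mat X" "symmetric_mat Y" for t X Y
  proof (rule affine_bounded_below_const)
    fix r :: real
    have "symmetric_mat (r *\<^sub>R X - all_ones)" "symmetric_mat (r *\<^sub>R Y)"
      using that by (auto simp: symmetric_mat_iff all_ones_def)
    from lower[OF this, of "r * t"]
    show "d \<le> mat_inner S all_ones + r * slope t X Y"
      unfolding lagrangian_line slope_def .
  qed
  have const: "lagrangian G S T a b m t X Y = mat_inner S all_ones"
    if "symmetric_mat X" "symmetric_mat Y" for t X Y
  proof -
    have "symmetric_mat (X + all_ones)"
      using that by (intro symmetric_mat_add symmetric_all_ones)
    \<comment> \<open>The line from the base point in the direction \<open>(t, X + J, Y)\<close>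
      reaches \<open>(t, X, Y)\<close> at \<open>r = 1\<close>.\<close>
    from zero[OF this that(2)] lagrangian_line[of G S T a b m 1 t "X + all_ones" Y]
    show ?thesis by (simp add: slope_def)
  qed
  have "ereal d = ereal (mat_inner S all_ones)"
    using fin lagrange_dual_fun_const[OF const] by simp
  then have d: "d = mat_inner all_ones S"
    by (simp add: mat_inner_eq_inner symST symmetric_all_ones inner_commute)
  have "edge_relations G S T"
  proof (rule edge_relations_if_orthogonal[OF G symST])
    fix A B assume AB: "edge_direction G A B"
    then have sym: "symmetric_mat A" "symmetric_mat B" by (auto simp: edge_direction_def)
    \<comment> \<open>With \<open>t = 0\<close>, an edge direction annihilates every equation
      term.\<close>
    have "slope 0 A B = - (S \<bullet> A) - T \<bullet> B"
      using AB unfolding slope_def edge_direction_def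
      by (auto simp: mat_inner_eq_inner intro!: sum.neutral)
    with zero[OF sym, of 0] show "S \<bullet> A + T \<bullet> B = 0" by linarith
  qed
  moreover have "trace (S + T) = 1"
  proof -
    \<comment> \<open>In the direction \<open>(1, I, I)\<close> only loops could contribute to the
      edge sum, and they are positive, so their two diagonal entries cancel.\<close>
    have "(\<Sum>(u, v, s) | ({u, v}, s) \<in> G.
        m (u, v, s) * ((mat 1 :: real^'a^'a) $ u $ v - of_int s * (mat 1 :: real^'a^'a) $ u $ v)) = 0"
      by (intro sum.neutral) (auto simp: mat_def dest: signed_graph_loop_sign[OF G])
    then have "slope 1 (mat 1) (mat 1) = 1 - trace (S + T)"
      unfolding slope_def
      by (simp add: mat_inner_def trace_add) (simp add: mat_def)
    with zero[OF symmetric_mat_1 symmetric_mat_1, of 1] show ?thesis by linarith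
  qed
  ultimately show ?thesis
    using psd d by (simp add: dual_feasible_iff)
qed

lemma is_lagrangian_dual_dual_feasible:
  assumes G: "signed_graph G"
  shows "is_lagrangian_dual G (dual_feasible G) (\<lambda>S T. mat_inner all_ones S)"
proof -
  have "\<exists>a b m. lagrange_dual_fun G S T a b m = ereal (mat_inner all_ones S)"
    if D: "dual_feasible G S T" for S T
  proof (intro exI)
    show "lagrange_dual_fun G S T (\<lambda>v. S $ v $ v) (\<lambda>v. T $ v $ v) (edge_multiplier S T)
            = ereal (mat_inner all_ones S)"
      by (rule lagrange_dual_fun_const) (rule lagrangian_dual_feasible[OF G D])
  qed
  moreover have "psd S \<and> psd T" if "dual_feasible G S T" for S T
    using that by (simp add: dual_feasible_def)
  ultimately show ?thesis
    unfolding is_lagrangian_dual_def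
    using dual_feasible_if_lagrange_dual_fun_finite[OF G] by blast
qed

section \<open>Attainment and strong duality\<close>

text \<open>A diagonal point satisfies the edge relations of any graph. It makes the dual feasible
  set nonempty, and its value 1 later bounds the optimum from below.\<close>

lemma dual_feasible_axis: "dual_feasible G (outer (axis v 1)) 0"
proof -
  have "outer (axis v 1) $ i $ j = 0" if "i \<noteq> j" for i j
    using that by (auto simp: outer_def axis_def)
  then show ?thesis
    by (simp add: dual_feasible_def psd_outer psd_0 trace_outer inner_axis_axis)
qed

lemma dual_optimal_exists: "\<exists>S T. dual_optimal G S T"
proof -
  let ?F = "{(S, T). dual_feasible G S T}"
  have "?F = {(X, Y). psd X \<and> psd Y \<and> trace (X + Y) = 1}
     \<inter> {p. edge_relations G (fst p) (snd p)}"
    by (auto simp: dual_feasible_iff)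
  \<comment> \<open>The premises of the relations depend only on the graph, so each relation is
    constantly true or a linear equation in \<open>p\<close>.\<close>
  moreover have "closed {p. edge_relations G (fst p) (snd p)}"
    unfolding edge_relations_def
    by (intro closed_Collect_conj closed_Collect_all closed_Collect_imp open_Collect_const
        closed_Collect_eq continuous_intros)
  ultimately have "compact ?F"
    by (simp only: compact_Int_closed compact_psd_trace)
  moreover have "?F \<noteq> {}"
    using dual_feasible_axis by blast
  moreover have "continuous_on ?F (\<lambda>p. all_ones \<bullet> fst p)"
    by (intro continuous_intros)
  ultimately obtain p where p: "p \<in> ?F" "\<forall>q\<in>?F. all_ones \<bullet> fst q \<le> all_ones \<bullet> fst p"
    using continuous_attains_sup by blast
  have "mat_inner all_ones S = all_ones \<bullet> S" if "dual_feasible G S T" for S T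
    using that by (simp add: dual_feasible_def psd_def mat_inner_eq_inner)
  with p have "dual_optimal G (fst p) (snd p)"
    unfolding dual_optimal_def by force
  then show ?thesis by blast
qed

section \<open>The affine space of the primal equations at a fixed \<open>t\<close>\<close>

definition primal_affine :: "('v::finite) signed_edges \<Rightarrow> real \<Rightarrow> ((real^'v^'v) \<times> (real^'v^'v)) set" where
  "primal_affine G t = {p. (\<forall>v. fst p $ v $ v = t - 1) \<and> (\<forall>v. snd p $ v $ v = t) \<and>
     (\<forall>u v s. ({u, v}, s) \<in> G \<longrightarrow> fst p $ u $ v - of_int s * snd p $ u $ v = -1)}"

lemma primal_affine_edge:
  assumes "p \<in> primal_affine G t" "({u, v}, s) \<in> G"
  shows "fst p $ u $ v = of_int s * snd p $ u $ v - 1"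
proof -
  have "fst p $ u $ v - of_int s * snd p $ u $ v = -1"
    using assms unfolding primal_affine_def by blast
  then show ?thesis by linarith
qed

lemma closed_primal_affine: "closed (primal_affine G t)"
  unfolding primal_affine_def
  by (intro closed_Collect_conj closed_Collect_all closed_Collect_imp open_Collect_const
        closed_Collect_eq continuous_intros)

lemma convex_primal_affine: "convex (primal_affine G t)"
proof (rule convexI)
  fix p q :: "(real^'a^'a) \<times> (real^'a^'a)" and x y :: real
  assume p: "p \<in> primal_affine G t" and q: "q \<in> primal_affine G t"
    and xy: "0 \<le> x" "0 \<le> y" "x + y = 1"
  have y: "y = 1 - x" using xy by simp
  show "x *\<^sub>R p + y *\<^sub>R q \<in> primal_affine G t"
    unfolding primal_affine_def mem_Collect_eq
  proof (intro conjI allI impI)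
    fix u v s assume "({u, v}, s) \<in> G"
    note 1 = primal_affine_edge[OF p this] primal_affine_edge[OF q this]
    show "fst (x *\<^sub>R p + y *\<^sub>R q) $ u $ v - of_int s * snd (x *\<^sub>R p + y *\<^sub>R q) $ u $ v = -1"
      by (simp add: 1 y algebra_simps)
  next
    fix v
    have 2: "fst p $ v $ v = t - 1" "fst q $ v $ v = t - 1" "snd p $ v $ v = t" "snd q $ v $ v = t"
      using p q by (auto simp: primal_affine_def)
    show "fst (x *\<^sub>R p + y *\<^sub>R q) $ v $ v = t - 1" "snd (x *\<^sub>R p + y *\<^sub>R q) $ v $ v = t"
      by (simp_all add: 2 y algebra_simps)
  qed
qed

lemma primal_affine_base: "signed_graph G \<Longrightarrow> (t *\<^sub>R mat 1 - all_ones, t *\<^sub>R mat 1) \<in> primal_affine G t"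
  by (auto simp: primal_affine_def mat_def all_ones_def dest: signed_graph_loop_sign)

lemma primal_affine_translate:
  assumes "p \<in> primal_affine G t" "edge_direction G A B"
  shows "p + r *\<^sub>R (A, B) \<in> primal_affine G t"
  unfolding primal_affine_def mem_Collect_eq
proof (intro conjI allI impI)
  fix u v s assume "({u, v}, s) \<in> G"
  then have 1: "fst p $ u $ v = of_int s * snd p $ u $ v - 1" "A $ u $ v = of_int s * B $ u $ v"
    using assms by (auto simp: edge_direction_def intro: primal_affine_edge)
  show "fst (p + r *\<^sub>R (A, B)) $ u $ v - of_int s * snd (p + r *\<^sub>R (A, B)) $ u $ v = -1"
    by (simp add: 1 algebra_simps)
next
  fix v
  have "fst p $ v $ v = t - 1" "snd p $ v $ v = t" "A $ v $ v = 0" "B $ v $ v = 0"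
    using assms by (auto simp: primal_affine_def edge_direction_def)
  then show "fst (p + r *\<^sub>R (A, B)) $ v $ v = t - 1" "snd (p + r *\<^sub>R (A, B)) $ v $ v = t"
    by simp_all
qed

text \<open>If the affine space of the primal equations at \<open>t = d\<close> missed the compact slice of the cone on
  which the trace has the value forced by those equations, a separating functional, shifted by a
  multiple of the identity and normalised, would be dual feasible with value larger than \<open>d\<close>.\<close>

lemma primal_feasible_at_dual_bound:
  fixes G :: "('v::finite) signed_edges"
  assumes G: "signed_graph G"
    and bound: "\<And>S T. dual_feasible G S T \<Longrightarrow> mat_inner all_ones S \<le> d"
  shows "\<exists>X Y. primal_feasible G d X Y"
proof (rule ccontr)
  assume none: "\<not> (\<exists>X Y. primal_feasible G d X Y)"
  \<comment> \<open>The diagonal equations force tr X = n (d - 1) and tr Y = n d.\<close>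
  define c where "c = real CARD('v) * (2 * d - 1)"
  define P where "P = {(X :: real^'v^'v, Y :: real^'v^'v). psd X \<and> psd Y \<and> trace (X + Y) = c}"
  have "mat_inner all_ones (outer (axis v 1)) = 1" for v :: 'v
    using psd_outer[of "axis v 1"]
    by (simp add: mat_inner_eq_inner psd_def inner_outer_axis) (simp add: all_ones_def)
  then have "1 \<le> d" using bound[OF dual_feasible_axis] by metis
  then have c: "c > 0" by (simp add: c_def)
  \<comment> \<open>These rank-one points, placed in either component, show that the slice is
    nonempty and later test the separating functional.\<close>
  have slice: "(c / (x \<bullet> x)) *\<^sub>R outer x \<in> {X. psd X \<and> trace X = c}" if "x \<noteq> 0" for x :: "real^'v"
    using that c by (simp add: psd_scaleR psd_outer trace_eq_inner)
      (simp add: trace_eq_inner[symmetric] trace_outer)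
  have "((c / (x \<bullet> x)) *\<^sub>R outer x, 0) \<in> P" if "x \<noteq> 0" for x
    using slice[OF that] psd_0 by (auto simp: P_def)
  then have "P \<noteq> {}"
    using axis_eq_0_iff[of undefined "1 :: real"] by fastforce
  moreover have "primal_feasible G d (fst p) (snd p)" if "p \<in> primal_affine G d" "p \<in> P" for p
    using that unfolding P_def primal_affine_def primal_feasible_def by (simp add: split_def)
  with none have "primal_affine G d \<inter> P = {}" by blast
  moreover have "convex P" "compact P"
    unfolding P_def by (rule convex_psd_trace compact_psd_trace)+
  ultimately have "\<exists>a b. (\<forall>p\<in>primal_affine G d. a \<bullet> p < b) \<and> (\<forall>p\<in>P. b < a \<bullet> p)"
    by (intro separating_hyperplane_closed_compact convex_primal_affine closed_primal_affine)
  then obtain a b where sep: "\<And>p. p \<in> primal_affine G d \<Longrightarrow> a \<bullet> p < b"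
      "\<And>p. p \<in> P \<Longrightarrow> b < a \<bullet> p"
    by blast
  define S0 T0 where "S0 = fst a" and "T0 = snd a"
  have a: "a = (S0, T0)" by (simp add: S0_def T0_def)
  \<comment> \<open>Symmetrising leaves pairings with symmetric matrices unchanged. The identity
    shift subtracts \<open>b\<close> from the functional wherever the total trace is
    \<open>c\<close>, moving the separation threshold to zero.\<close>
  define S where "S = (1/2) *\<^sub>R (S0 + transpose S0) - (b / c) *\<^sub>R mat 1"
  define T where "T = (1/2) *\<^sub>R (T0 + transpose T0) - (b / c) *\<^sub>R mat 1"
  have sym: "symmetric_mat S" "symmetric_mat T"
    by (auto simp: S_def T_def symmetric_mat_iff transpose_def mat_def)
  have S_inner: "S \<bullet> X = S0 \<bullet> X - (b / c) * trace X" if "symmetric_mat X" for X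
    using that inner_transpose[of S0 X]
    by (simp add: S_def inner_diff_left inner_add_left symmetric_mat_def trace_eq_inner
        inner_commute[of "mat 1"])
  have T_inner: "T \<bullet> X = T0 \<bullet> X - (b / c) * trace X" if "symmetric_mat X" for X
    using that inner_transpose[of T0 X]
    by (simp add: T_def inner_diff_left inner_add_left symmetric_mat_def trace_eq_inner
        inner_commute[of "mat 1"])
  have "0 < S \<bullet> outer x \<and> 0 < T \<bullet> outer x" if "x \<noteq> 0" for x
  proof -
    have "((c / (x \<bullet> x)) *\<^sub>R outer x, 0) \<in> P" "(0, (c / (x \<bullet> x)) *\<^sub>R outer x) \<in> P"
      using slice[OF that] psd_0 by (auto simp: P_def)
    then have "b < c / (x \<bullet> x) * (S0 \<bullet> outer x)" "b < c / (x \<bullet> x) * (T0 \<bullet> outer x)"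
      using sep(2) by (fastforce simp: a)+
    moreover have "0 < x \<bullet> x" using that by simp
    moreover have "symmetric_mat (outer x)" using psd_outer psd_def by blast
    ultimately show ?thesis
      using c by (simp add: S_inner T_inner trace_outer field_simps)
  qed
  note strict = this
  have "0 \<le> S \<bullet> outer x \<and> 0 \<le> T \<bullet> outer x" for x
    using strict[of x] by (cases "x = 0") (auto simp: inner_outer)
  then have psd: "psd S" "psd T" using sym by (auto simp: psd_iff)
  have "0 < S $ v $ v \<and> 0 < T $ v $ v" for v
    using strict[of "axis v 1"] by (simp add: inner_outer_axis axis_eq_0_iff)
  then have tr: "0 < trace (S + T)"
    unfolding trace_def by (intro sum_pos) (auto intro: add_pos_pos)
  let ?z = "(d *\<^sub>R mat 1 - all_ones, d *\<^sub>R mat 1) :: (real^'v^'v) \<times> (real^'v^'v)"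
  have z: "?z \<in> primal_affine G d" by (rule primal_affine_base[OF G])
  have rel: "edge_relations G S T"
  proof (rule edge_relations_if_orthogonal[OF G sym])
    fix A B assume AB: "edge_direction G A B"
    \<comment> \<open>The functional stays below \<open>b\<close> on the whole line through
      \<open>?z\<close>, so its slope vanishes. Passing to \<open>S\<close> and \<open>T\<close>
      keeps this, since \<open>A\<close> and \<open>B\<close> are symmetric with trace zero.\<close>
    have "- (a \<bullet> (A, B)) = 0"
    proof (rule affine_bounded_below_const)
      fix r
      show "- b \<le> - (a \<bullet> ?z) + r * - (a \<bullet> (A, B))"
        using sep(1)[OF primal_affine_translate[OF z AB, of r]]
        unfolding inner_add_right inner_scaleR_right by linarith
    qed
    moreover have "symmetric_mat A" "symmetric_mat B" "trace A = 0" "trace B = 0"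
      using AB by (auto simp: edge_direction_def trace_def)
    ultimately show "S \<bullet> A + T \<bullet> B = 0"
      by (simp add: S_inner T_inner a)
  qed
  \<comment> \<open>The components of \<open>?z\<close> have total trace \<open>c\<close>, so their
    pairing with \<open>(S, T)\<close> is negative. Expanded, it compares \<open>d\<close> with the
    dual value before normalisation.\<close>
  define Z1 Z2 :: "real^'v^'v" where "Z1 = d *\<^sub>R mat 1 - all_ones" and "Z2 = d *\<^sub>R mat 1"
  have "trace Z1 + trace Z2 = c"
    by (simp add: Z1_def Z2_def trace_def mat_def all_ones_def c_def sum_subtractf algebra_simps)
  then have "(b / c) * (trace Z1 + trace Z2) = b"
    using c by simp
  then have "(b / c) * trace Z1 + (b / c) * trace Z2 = b"
    unfolding distrib_left .
  moreover have "symmetric_mat Z1" "symmetric_mat Z2"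
    by (auto simp: Z1_def Z2_def symmetric_mat_iff mat_def all_ones_def)
  then have "S \<bullet> Z1 = S0 \<bullet> Z1 - (b / c) * trace Z1" "T \<bullet> Z2 = T0 \<bullet> Z2 - (b / c) * trace Z2"
    by (simp_all only: S_inner T_inner)
  moreover have "S0 \<bullet> Z1 + T0 \<bullet> Z2 < b"
    using sep(1)[OF z] unfolding a inner_Pair Z1_def Z2_def .
  ultimately have "S \<bullet> Z1 + T \<bullet> Z2 < 0" by linarith
  moreover have "S \<bullet> Z1 + T \<bullet> Z2 = d * trace (S + T) - all_ones \<bullet> S"
    by (simp add: Z1_def Z2_def inner_diff_right trace_eq_inner inner_add_left
        inner_commute[of S all_ones] distrib_left)
  ultimately have "d < all_ones \<bullet> S / trace (S + T)"
    using tr by (simp add: field_simps)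
  moreover have "dual_feasible G ((1 / trace (S + T)) *\<^sub>R S) ((1 / trace (S + T)) *\<^sub>R T)"
    unfolding dual_feasible_iff
  proof (intro conjI)
    show "trace ((1 / trace (S + T)) *\<^sub>R S + (1 / trace (S + T)) *\<^sub>R T) = 1"
      using tr by (simp only: trace_eq_inner inner_scaleR_left flip: scaleR_add_right) simp
    show "edge_relations G ((1 / trace (S + T)) *\<^sub>R S) ((1 / trace (S + T)) *\<^sub>R T)"
      using rel unfolding edge_relations_def
      by (simp flip: add_divide_distrib diff_divide_distrib)
  qed (use psd tr in \<open>auto intro!: psd_scaleR\<close>)
  from bound[OF this] have "all_ones \<bullet> S / trace (S + T) \<le> d"
    by (simp add: mat_inner_eq_inner symmetric_mat_scaleR sym)
  ultimately show False by linarith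
qed

theorem theorem4p2:
  fixes G :: "('v::finite) signed_edges"
  assumes "signed_graph G"
  shows "is_lagrangian_dual (loop_completion G)
           (dual_feasible (loop_completion G)) (\<lambda>S T. mat_inner all_ones S)
       \<and> (\<exists>t X Y. primal_optimal (loop_completion G) t X Y)
       \<and> (\<exists>S T. dual_optimal (loop_completion G) S T)
       \<and> (\<forall>t X Y S T. primal_optimal (loop_completion G) t X Y \<and> dual_optimal (loop_completion G) S T
            \<longrightarrow> t = mat_inner all_ones S)"
proof -
  let ?G = "loop_completion G"
  have G: "signed_graph ?G" using assms by (rule signed_graph_loop_completion)
  \<comment> \<open>Separation gives a primal point at the dual optimum, and weak duality makes it
    optimal.\<close>
  have strong: "\<exists>X Y. primal_optimal ?G (mat_inner all_ones S) X Y" if "dual_optimal ?G S T" for S T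
    using that primal_feasible_at_dual_bound[OF G, of "mat_inner all_ones S"] weak_duality[OF G]
    unfolding dual_optimal_def primal_optimal_def by blast
  obtain S T where "dual_optimal ?G S T" using dual_optimal_exists by blast
  moreover have "t = mat_inner all_ones S"
    if "primal_optimal ?G t X Y" "dual_optimal ?G S T" for t X Y S T
    using strong[OF that(2)] that(1) unfolding primal_optimal_def by (meson order_antisym)
  ultimately show ?thesis
    using is_lagrangian_dual_dual_feasible[OF G] strong by blast
qed

end
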